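(* For any $\rho,s\in[0,1)$, $$\mathbb{E}\exp\big\{\rho\,\mu(\widetilde{\boldsymbol{\theta}})L(\widetilde{\boldsymbol{\theta}},\boldsymbol{\theta}_0)\big\}\le\mathfrak{Q}(\rho,0),\qquad \mathbb{E}\exp\big\{\rho s\,\mathfrak{M}(\widetilde{\boldsymbol{\theta}},\boldsymbol{\theta}_0)\big\}\le\mathfrak{Q}(\rho,s).$$
   Context: $L(\boldsymbol{\theta})$, $\boldsymbol{\theta}\in\Theta\subset\mathbb{R}^p$, is a separable real-valued random field on a probability space $(\Omega,\mathcal{F},\mathbb{P})$ with expectation $\mathbb{E}$, and $\mathbb{E}L(\boldsymbol{\theta})$ exists for all $\boldsymbol{\theta}\in\Theta$. Notation: $L(\boldsymbol{\theta},\boldsymbol{\theta}')=L(\boldsymbol{\theta})-L(\boldsymbol{\theta}')$. The point $\boldsymbol{\theta}_0\in\Theta$ is a maximizer of $\boldsymbol{\theta}\mapsto\mathbb{E}L(\boldsymbol{\theta})$, and the (random) minimum contrast estimator $\widetilde{\boldsymbol{\theta}}\in\Theta$ is a maximizer of $\boldsymbol{\theta}\mapsto L(\boldsymbol{\theta})$ over $\Theta$. It is assumed that for every $\boldsymbol{\theta}\in\Theta$ the set $\Upsilon(\boldsymbol{\theta})=\{\mu\in(0,\infty):\mathbb{E}\exp\{\mu L(\boldsymbol{\theta},\boldsymbol{\theta}_0)\}<\infty\}$ is non-empty; a function $\mu(\cdot)$ with $\mu(\boldsymbol{\theta})\in\Upsilon(\boldsymbol{\theta})$ is fixed, and $\mathfrak{M}(\boldsymbol{\theta},\boldsymbol{\theta}_0)=-\log\mathbb{E}\exp\{\mu(\boldsymbol{\theta})L(\boldsymbol{\theta},\boldsymbol{\theta}_0)\}$.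 For $\rho,s\in[0,1]$, $$\mathfrak{Q}(\rho,s)=\mathbb{E}\sup_{\boldsymbol{\theta}\in\Theta}\exp\Big\{\rho\big[\mu(\boldsymbol{\theta})L(\boldsymbol{\theta},\boldsymbol{\theta}_0)+s\,\mathfrak{M}(\boldsymbol{\theta},\boldsymbol{\theta}_0)\big]\Big\}.$$ *)

theory Defs
  imports "HOL-Probability.Probability"
begin

text \<open>
  A random field \<open>L\<close> indexed by \<open>T\<close> is a family of real random variables; \<open>L \<theta> \<omega>\<close> is its value
  at the index \<open>\<theta>\<close> and the outcome \<open>\<omega>\<close>. Separability is meant in the usual sense: outside one
  null set \<open>N\<close>, for every relatively open piece \<open>T \<inter> U\<close> of the index set and every closed \<open>B\<close>,
  the path stays in \<open>B\<close> on \<open>T \<inter> U\<close> iff it does so on the points of the countable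
  dense subset \<open>D\<close> lying in \<open>U\<close> (the forward implication being trivial).
\<close>

definition separable_random_field ::
    "'w measure \<Rightarrow> 'a::topological_space set \<Rightarrow> ('a \<Rightarrow> 'w \<Rightarrow> real) \<Rightarrow> bool" where
  "separable_random_field M T L \<longleftrightarrow>
     (\<forall>\<theta>\<in>T. L \<theta> \<in> borel_measurable M) \<and>
     (\<exists>D N. countable D \<and> D \<subseteq> T \<and> T \<subseteq> closure D \<and> N \<in> null_sets M \<and>
        (\<forall>U B. open U \<longrightarrow> closed B \<longrightarrow>
           (\<forall>\<omega>\<in>space M - N.
              (\<forall>\<theta>\<in>T \<inter> U. L \<theta> \<omega> \<in> B) \<longleftrightarrow> (\<forall>\<theta>\<in>D \<inter> U. L \<theta> \<omega> \<in> B))))"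

definition increment :: "('a \<Rightarrow> 'w \<Rightarrow> real) \<Rightarrow> 'a \<Rightarrow> 'a \<Rightarrow> 'w \<Rightarrow> real" where
  "increment L \<theta> \<theta>' \<omega> = L \<theta> \<omega> - L \<theta>' \<omega>"

text \<open>
  Expectations of nonnegative quantities that may be infinite are \<^const>\<open>nn_integral\<close>s,
  with values in \<open>[0, \<infinity>]\<close>.
\<close>

definition Upsilon :: "'w measure \<Rightarrow> ('a \<Rightarrow> 'w \<Rightarrow> real) \<Rightarrow> 'a \<Rightarrow> 'a \<Rightarrow> real set" where
  "Upsilon M L \<theta>\<^sub>0 \<theta> =
     {m. 0 < m \<and> (\<integral>\<^sup>+ \<omega>. ennreal (exp (m * increment L \<theta> \<theta>\<^sub>0 \<omega>)) \<partial>M) < \<infinity>}"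

text \<open>
  The real-valued integral below is the true expectation as soon as \<open>\<mu> \<theta> \<in> Upsilon M L \<theta>\<^sub>0 \<theta>\<close>.
\<close>

definition rate :: "'w measure \<Rightarrow> ('a \<Rightarrow> 'w \<Rightarrow> real) \<Rightarrow> ('a \<Rightarrow> real) \<Rightarrow> 'a \<Rightarrow> 'a \<Rightarrow> real" where
  "rate M L \<mu> \<theta> \<theta>\<^sub>0 = - ln (\<integral>\<omega>. exp (\<mu> \<theta> * increment L \<theta> \<theta>\<^sub>0 \<omega>) \<partial>M)"

text \<open>
  The supremum is taken over an index set that need not be countable and \<open>\<mu>\<close> need not be measurable.
  Where an integrand fails to be measurable, \<^const>\<open>nn_integral\<close> is the lower integral.
\<close>

definition Q_bound ::
    "'w measure \<Rightarrow> 'a set \<Rightarrow> ('a \<Rightarrow> 'w \<Rightarrow> real) \<Rightarrow> ('a \<Rightarrow> real) \<Rightarrow> 'a \<Rightarrow> real \<Rightarrow> real \<Rightarrow> ennreal" where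
  "Q_bound M T L \<mu> \<theta>\<^sub>0 \<rho> s =
     (\<integral>\<^sup>+ \<omega>. (SUP \<theta>\<in>T. ennreal (exp (\<rho> * (\<mu> \<theta> * increment L \<theta> \<theta>\<^sub>0 \<omega> + s * rate M L \<mu> \<theta> \<theta>\<^sub>0)))) \<partial>M)"

end

theory Submission
  imports Defs
begin

text \<open>
  Both bounds hold pathwise and are then integrated. The supremum over \<open>\<Theta>\<close> dominates its
  integrand at the random point \<open>\<theta>t \<omega> \<in> \<Theta>\<close>; for \<open>s = 0\<close> this value is the first integrand. For
  the second bound, one drops from the exponent the term
  \<open>\<rho> * \<mu> (\<theta>t \<omega>) * increment L (\<theta>t \<omega>) \<theta>\<^sub>0 \<omega>\<close>, which is nonnegative: the path \<open>L _ \<omega>\<close> is maximal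
  at \<open>\<theta>t \<omega>\<close>, so its value there is at least the one at \<open>\<theta>\<^sub>0\<close>, \<open>\<rho>\<close> is nonnegative and \<open>\<mu>\<close> is positive on \<open>\<Theta>\<close>.
  Integration preserves the pathwise inequalities whether or not the integrands are measurable,
  because the lower integral is monotone.
\<close>

lemma nn_integral_at_random_point_le_Q_bound:
  assumes "\<And>\<omega>. \<omega> \<in> space M \<Longrightarrow> \<tau> \<omega> \<in> T"
    and "\<And>\<omega>. \<omega> \<in> space M \<Longrightarrow>
      g \<omega> \<le> \<rho> * (\<mu> (\<tau> \<omega>) * increment L (\<tau> \<omega>) \<theta>\<^sub>0 \<omega> + s * rate M L \<mu> (\<tau> \<omega>) \<theta>\<^sub>0)"
  shows "(\<integral>\<^sup>+ \<omega>. ennreal (exp (g \<omega>)) \<partial>M) \<le> Q_bound M T L \<mu> \<theta>\<^sub>0 \<rho> s"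
  unfolding Q_bound_def
proof (rule nn_integral_mono)
  fix \<omega> assume "\<omega> \<in> space M"
  with assms show "ennreal (exp (g \<omega>))
      \<le> (SUP \<theta>\<in>T. ennreal (exp (\<rho> * (\<mu> \<theta> * increment L \<theta> \<theta>\<^sub>0 \<omega> + s * rate M L \<mu> \<theta> \<theta>\<^sub>0))))"
    by (intro SUP_upper2[of "\<tau> \<omega>"] ennreal_leI) auto
qed

lemma increment_arg_max_nonneg:
  assumes "is_arg_max (\<lambda>\<theta>. L \<theta> \<omega>) (\<lambda>\<theta>. \<theta> \<in> T) \<tau>" and "\<theta>\<^sub>0 \<in> T"
  shows "0 \<le> increment L \<tau> \<theta>\<^sub>0 \<omega>"
  using assms by (auto simp: is_arg_max_def increment_def not_less)

theorem corollary2p4: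
  fixes M :: "'w measure"
    and \<Theta> :: "(real ^ 'p) set"
    and L :: "real ^ 'p \<Rightarrow> 'w \<Rightarrow> real"
    and \<theta>\<^sub>0 :: "real ^ 'p"
    and \<theta>t :: "'w \<Rightarrow> real ^ 'p"
    and \<mu> :: "real ^ 'p \<Rightarrow> real"
    and \<rho> s :: real
  assumes "prob_space M"
    and "separable_random_field M \<Theta> L"
    and "\<And>\<theta>. \<theta> \<in> \<Theta> \<Longrightarrow> integrable M (L \<theta>)"
    and "is_arg_max (\<lambda>\<theta>. \<integral>\<omega>. L \<theta> \<omega> \<partial>M) (\<lambda>\<theta>. \<theta> \<in> \<Theta>) \<theta>\<^sub>0"
    and "\<theta>t \<in> borel_measurable M"
    and "\<And>\<omega>. \<omega> \<in> space M \<Longrightarrow> is_arg_max (\<lambda>\<theta>. L \<theta> \<omega>) (\<lambda>\<theta>. \<theta> \<in> \<Theta>) (\<theta>t \<omega>)"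
    and "\<And>\<theta>. \<theta> \<in> \<Theta> \<Longrightarrow> Upsilon M L \<theta>\<^sub>0 \<theta> \<noteq> {}"
    and "\<And>\<theta>. \<theta> \<in> \<Theta> \<Longrightarrow> \<mu> \<theta> \<in> Upsilon M L \<theta>\<^sub>0 \<theta>"
    and "\<rho> \<in> {0..<1}"
    and "s \<in> {0..<1}"
  shows "(\<integral>\<^sup>+ \<omega>. ennreal (exp (\<rho> * \<mu> (\<theta>t \<omega>) * increment L (\<theta>t \<omega>) \<theta>\<^sub>0 \<omega>)) \<partial>M)
           \<le> Q_bound M \<Theta> L \<mu> \<theta>\<^sub>0 \<rho> 0
       \<and> (\<integral>\<^sup>+ \<omega>. ennreal (exp (\<rho> * s * rate M L \<mu> (\<theta>t \<omega>) \<theta>\<^sub>0)) \<partial>M)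
           \<le> Q_bound M \<Theta> L \<mu> \<theta>\<^sub>0 \<rho> s"
proof
  have in_index: "\<theta>t \<omega> \<in> \<Theta>" if "\<omega> \<in> space M" for \<omega>
    using assms(6)[OF that] by (simp add: is_arg_max_def)
  have "\<theta>\<^sub>0 \<in> \<Theta>"
    using assms(4) by (simp add: is_arg_max_def)
  show "(\<integral>\<^sup>+ \<omega>. ennreal (exp (\<rho> * \<mu> (\<theta>t \<omega>) * increment L (\<theta>t \<omega>) \<theta>\<^sub>0 \<omega>)) \<partial>M)
      \<le> Q_bound M \<Theta> L \<mu> \<theta>\<^sub>0 \<rho> 0"
    by (rule nn_integral_at_random_point_le_Q_bound[where \<tau> = \<theta>t]) (simp_all add: in_index)
  show "(\<integral>\<^sup>+ \<omega>. ennreal (exp (\<rho> * s * rate M L \<mu> (\<theta>t \<omega>) \<theta>\<^sub>0)) \<partial>M)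
      \<le> Q_bound M \<Theta> L \<mu> \<theta>\<^sub>0 \<rho> s"
  proof (rule nn_integral_at_random_point_le_Q_bound[where \<tau> = \<theta>t])
    fix \<omega> assume \<omega>: "\<omega> \<in> space M"
    then show "\<theta>t \<omega> \<in> \<Theta>"
      by (rule in_index)
    have "0 < \<mu> (\<theta>t \<omega>)"
      using assms(8)[OF in_index[OF \<omega>]] by (simp add: Upsilon_def)
    moreover have "0 \<le> increment L (\<theta>t \<omega>) \<theta>\<^sub>0 \<omega>"
      using assms(6)[OF \<omega>] \<open>\<theta>\<^sub>0 \<in> \<Theta>\<close> by (rule increment_arg_max_nonneg)
    ultimately have "0 \<le> \<rho> * (\<mu> (\<theta>t \<omega>) * increment L (\<theta>t \<omega>) \<theta>\<^sub>0 \<omega>)"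
      using assms(9) by simp
    then show "\<rho> * s * rate M L \<mu> (\<theta>t \<omega>) \<theta>\<^sub>0
        \<le> \<rho> * (\<mu> (\<theta>t \<omega>) * increment L (\<theta>t \<omega>) \<theta>\<^sub>0 \<omega> + s * rate M L \<mu> (\<theta>t \<omega>) \<theta>\<^sub>0)"
      by (simp add: distrib_left mult.assoc)
  qed
qed

end
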